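(* Let $\Delta$ be a finite abstract simplicial complex and $\Delta'$ a subcomplex of $\Delta$. If $\Delta$ $\mathrm{LC}$-reduces to $\Delta'$, then $\Delta$ $\mathrm{NE}$-reduces to $\Delta'$; in particular, $\Delta$ collapses to $\Delta'$.
   Context: $[k]=\{1,\dots,k\}$. For a simplicial complex $\Delta$ with vertex set $V$, a facet is a maximal face and $\mathcal{F}(v)$ is the set of facets containing the vertex $v$. For $\kappa\colon V\to[k]$ and a face $S$, $S_\kappa$ is the multiset on $[k]$ with $S_\kappa(t)=|\{v\in S:\kappa(v)=t\}|$; for multisets $\|M\|=\sum_tM(t)$ and $(M\cap M')(t)=\min(M(t),M'(t))$. A $k$-linear coloring is a surjective $\kappa\colon V\to[k]$ with $\|F_\kappa\cap F'_\kappa\|=|F\cap F'|$ for all facets $F,F'$. A representative subcomplex with respect to $\kappa$ is a subcomplex $\{S\in\Delta:S\subseteq W\}$ induced on a set $W\subseteq V$ containing exactly one vertex of each color, such that $\mathcal{F}(x)\subseteq\mathcal{F}(y)$ whenever $x\in V$, $y\in W$, $\kappa(x)=\kappa(y)$. $\Delta$ $\mathrm{LC}$-reduces to $\Delta'$ if there is a sequence $\Delta=\Delta_0\supseteq\Delta_1\supseteq\dots\supseteq\Delta_t=\Delta'$ such that for each $0\le r\le t-1$, $\Delta_{r+1}$ is a representative subcomplex of $\Delta_r$ with respect to some linear coloring of $\Delta_r$ (on the vertex set of $\Delta_r$). For a vertex $v$: $\mathrm{del}_\Delta(v)=\{S\in\Delta:v\notin S\}$, $\mathrm{lk}_\Delta(v)=\{S\in\Delta:v\notin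 S,\ S\cup\{v\}\in\Delta\}$. Nonevasiveness is defined inductively: a one-point complex is nonevasive, and $\Delta$ is nonevasive if it has a vertex $v$ with $\mathrm{del}_\Delta(v)$ and $\mathrm{lk}_\Delta(v)$ both nonevasive. $\Delta$ $\mathrm{NE}$-reduces to $\Delta'$ if there are subcomplexes $\Delta=\Delta^1,\Delta^2,\dots,\Delta^{t+1}=\Delta'$ and vertices $v_1,\dots,v_t$ with $\Delta^{r+1}=\mathrm{del}_{\Delta^r}(v_r)$ (so $V(\Delta^r)=V(\Delta^{r+1})\cup\{v_r\}$) and $\mathrm{lk}_{\Delta^r}(v_r)$ nonevasive for all $1\le r\le t$. A face $S$ is free if it is not maximal and lies in a unique maximal face; removing all faces containing a free face $S$ is an elementary collapse; $\Delta$ collapses to $\Delta'$ if $\Delta'$ is obtained from $\Delta$ by a sequence of elementary collapses. *)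

theory Defs
  imports Main "HOL-Library.Multiset"
begin

text \<open>
  A complex is the set of its faces, the empty face included; its vertex set is the union of its
  faces. Neither the void complex without any face nor the complex whose only face is the empty
  one is excluded.
\<close>

definition finite_simplicial_complex :: "'a set set \<Rightarrow> bool" where
  "finite_simplicial_complex \<Delta> \<longleftrightarrow>
     finite \<Delta> \<and> (\<forall>S\<in>\<Delta>. finite S) \<and> (\<forall>S\<in>\<Delta>. \<forall>T. T \<subseteq> S \<longrightarrow> T \<in> \<Delta>)"

definition subcomplex :: "'a set set \<Rightarrow> 'a set set \<Rightarrow> bool" where
  "subcomplex \<Delta>' \<Delta> \<longleftrightarrow> finite_simplicial_complex \<Delta>' \<and> \<Delta>' \<subseteq> \<Delta>"

definition verts :: "'a set set \<Rightarrow> 'a set" where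
  "verts \<Delta> = \<Union>\<Delta>"

definition facets :: "'a set set \<Rightarrow> 'a set set" where
  "facets \<Delta> = {F \<in> \<Delta>. \<forall>G\<in>\<Delta>. F \<subseteq> G \<longrightarrow> G = F}"

definition facets_at :: "'a set set \<Rightarrow> 'a \<Rightarrow> 'a set set" where
  "facets_at \<Delta> v = {F \<in> facets \<Delta>. v \<in> F}"

definition induced_subcomplex :: "'a set set \<Rightarrow> 'a set \<Rightarrow> 'a set set" where
  "induced_subcomplex \<Delta> W = {S \<in> \<Delta>. S \<subseteq> W}"

definition deletion :: "'a set set \<Rightarrow> 'a \<Rightarrow> 'a set set" where
  "deletion \<Delta> v = {S \<in> \<Delta>. v \<notin> S}"

definition link :: "'a set set \<Rightarrow> 'a \<Rightarrow> 'a set set" where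
  "link \<Delta> v = {S \<in> \<Delta>. v \<notin> S \<and> insert v S \<in> \<Delta>}"

definition color_mset :: "('a \<Rightarrow> nat) \<Rightarrow> 'a set \<Rightarrow> nat multiset" where
  "color_mset \<kappa> S = image_mset \<kappa> (mset_set S)"

lemma count_color_mset:
  assumes "finite S"
  shows "count (color_mset \<kappa> S) t = card {v \<in> S. \<kappa> v = t}"
proof -
  have "{v \<in> S. \<kappa> v = t} = \<kappa> -` {t} \<inter> S"
    by auto
  then show ?thesis
    using assms by (simp add: color_mset_def count_image_mset)
qed

text \<open>Only the values of \<open>\<kappa>\<close> on the vertex set matter.\<close>

definition linear_coloring :: "'a set set \<Rightarrow> nat \<Rightarrow> ('a \<Rightarrow> nat) \<Rightarrow> bool" where
  "linear_coloring \<Delta> k \<kappa> \<longleftrightarrow>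
     \<kappa> ` verts \<Delta> = {1..k} \<and>
     (\<forall>F\<in>facets \<Delta>. \<forall>F'\<in>facets \<Delta>.
        size (color_mset \<kappa> F \<inter># color_mset \<kappa> F') = card (F \<inter> F'))"

definition representative_subcomplex ::
  "'a set set \<Rightarrow> nat \<Rightarrow> ('a \<Rightarrow> nat) \<Rightarrow> 'a set set \<Rightarrow> bool" where
  "representative_subcomplex \<Delta> k \<kappa> \<Delta>' \<longleftrightarrow>
     (\<exists>W. W \<subseteq> verts \<Delta> \<and>
          (\<forall>t\<in>{1..k}. \<exists>!w. w \<in> W \<and> \<kappa> w = t) \<and>
          (\<forall>x\<in>verts \<Delta>. \<forall>y\<in>W. \<kappa> x = \<kappa> y \<longrightarrow> facets_at \<Delta> x \<subseteq> facets_at \<Delta> y) \<and>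
          \<Delta>' = induced_subcomplex \<Delta> W)"

definition LC_step :: "'a set set \<Rightarrow> 'a set set \<Rightarrow> bool" where
  "LC_step \<Delta> \<Delta>' \<longleftrightarrow>
     (\<exists>k \<kappa>. linear_coloring \<Delta> k \<kappa> \<and> representative_subcomplex \<Delta> k \<kappa> \<Delta>')"

definition LC_reduces :: "'a set set \<Rightarrow> 'a set set \<Rightarrow> bool" where
  "LC_reduces = LC_step\<^sup>*\<^sup>*"

text \<open>
  The one-point complex consists of the empty face and one vertex; the complex whose only face is
  empty is not nonevasive.
\<close>

inductive nonevasive :: "'a set set \<Rightarrow> bool" where
  point: "nonevasive {{}, {x}}"
| del_link: "finite_simplicial_complex \<Delta> \<Longrightarrow> v \<in> verts \<Delta> \<Longrightarrow>
    nonevasive (deletion \<Delta> v) \<Longrightarrow> nonevasive (link \<Delta> v) \<Longrightarrow> nonevasive \<Delta>"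

definition NE_step :: "'a set set \<Rightarrow> 'a set set \<Rightarrow> bool" where
  "NE_step \<Delta> \<Delta>' \<longleftrightarrow>
     (\<exists>v\<in>verts \<Delta>. \<Delta>' = deletion \<Delta> v \<and> nonevasive (link \<Delta> v))"

definition NE_reduces :: "'a set set \<Rightarrow> 'a set set \<Rightarrow> bool" where
  "NE_reduces = NE_step\<^sup>*\<^sup>*"

text \<open>
  Free faces are required to be nonempty, as usual for collapses: removing all faces containing
  the empty face would turn a simplex into the void complex. Since a void complex cannot be
  collapsed any further, this restriction has no influence on which nonvoid complexes can be
  reached by collapsing.
\<close>

definition free_face :: "'a set set \<Rightarrow> 'a set \<Rightarrow> bool" where
  "free_face \<Delta> S \<longleftrightarrow>
     S \<in> \<Delta> \<and> S \<noteq> {} \<and> S \<notin> facets \<Delta> \<and> (\<exists>!F. F \<in> facets \<Delta> \<and> S \<subseteq> F)"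

definition elementary_collapse :: "'a set set \<Rightarrow> 'a set set \<Rightarrow> bool" where
  "elementary_collapse \<Delta> \<Delta>' \<longleftrightarrow> (\<exists>S. free_face \<Delta> S \<and> \<Delta>' = {T \<in> \<Delta>. \<not> S \<subseteq> T})"

definition collapses :: "'a set set \<Rightarrow> 'a set set \<Rightarrow> bool" where
  "collapses = elementary_collapse\<^sup>*\<^sup>*"

end

(* Suppose x and y have the same color and y is the chosen representative of that color. As every
   facet containing x contains y, the link of x is a cone with apex y; this survives the deletion
   of other vertices as long as y is kept. Hence the vertices outside the representative set can be
   deleted one at a time. Cones are nonevasive, which gives the NE-reduction, and matching S
   with S \<union> {y}, for the faces S containing x but not y, gives the collapse. *)

theory Submission
  imports Defs
begin

lemma complex_facet_above:
  assumes "finite_simplicial_complex \<Delta>" "S \<in> \<Delta>"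
  obtains F where "F \<in> facets \<Delta>" "S \<subseteq> F"
proof -
  have "finite {T \<in> \<Delta>. S \<subseteq> T}"
    using assms(1) by (simp add: finite_simplicial_complex_def)
  moreover have "S \<in> {T \<in> \<Delta>. S \<subseteq> T}"
    using assms(2) by simp
  ultimately obtain F where F: "F \<in> {T \<in> \<Delta>. S \<subseteq> T}"
    and max: "\<forall>G\<in>{T \<in> \<Delta>. S \<subseteq> T}. F \<subseteq> G \<longrightarrow> F = G"
    by (metis (lifting) finite_has_maximal2)
  have "G = F" if "G \<in> \<Delta>" "F \<subseteq> G" for G
    using F max that by blast
  then have "F \<in> facets \<Delta>" "S \<subseteq> F"
    using F by (simp_all add: facets_def)
  then show thesis
    by (rule that)
qed

text \<open>A facet above \<open>S\<close> contains \<open>x\<close>, hence \<open>y\<close>, so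
  \<open>insert y S\<close> lies in that facet. The rest of the proof uses only this form of
  domination, stated for faces: deleting a vertex can create new facets, so an inclusion between
  sets of facets is awkward to carry along, whereas closure of faces under adding \<open>y\<close>
  restricts well.\<close>

lemma facets_at_subset_insert_mem:
  assumes \<Delta>: "finite_simplicial_complex \<Delta>" and sub: "facets_at \<Delta> x \<subseteq> facets_at \<Delta> y"
    and "S \<in> \<Delta>" "x \<in> S"
  shows "insert y S \<in> \<Delta>"
proof -
  obtain F where F: "F \<in> facets \<Delta>" "S \<subseteq> F"
    using complex_facet_above[OF \<Delta> \<open>S \<in> \<Delta>\<close>] .
  then have "F \<in> facets_at \<Delta> x"
    using \<open>x \<in> S\<close> by (auto simp: facets_at_def)
  then have "y \<in> F" "F \<in> \<Delta>"
    using sub by (auto simp: facets_at_def facets_def)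
  then have "insert y S \<subseteq> F" "F \<in> \<Delta>"
    using F by auto
  then show ?thesis
    using \<Delta> unfolding finite_simplicial_complex_def by blast
qed

lemma complex_deletion:
  "finite_simplicial_complex \<Delta> \<Longrightarrow> finite_simplicial_complex (deletion \<Delta> v)"
  by (auto simp: finite_simplicial_complex_def deletion_def)

lemma complex_link:
  assumes "finite_simplicial_complex \<Delta>"
  shows "finite_simplicial_complex (link \<Delta> v)"
proof -
  have "T \<in> link \<Delta> v" if "S \<in> link \<Delta> v" "T \<subseteq> S" for S T
  proof -
    have "insert v T \<subseteq> insert v S"
      using that by blast
    then show ?thesis
      using that assms unfolding finite_simplicial_complex_def link_def by blast
  qed
  moreover have "finite (link \<Delta> v)" "\<forall>S\<in>link \<Delta> v. finite S"
    using assms by (simp_all add: finite_simplicial_complex_def link_def)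
  ultimately show ?thesis
    unfolding finite_simplicial_complex_def by blast
qed

lemma finite_verts: "finite_simplicial_complex \<Delta> \<Longrightarrow> finite (verts \<Delta>)"
  by (auto simp: finite_simplicial_complex_def verts_def)

lemma verts_deletion:
  assumes "finite_simplicial_complex \<Delta>"
  shows "verts (deletion \<Delta> v) = verts \<Delta> - {v}"
proof
  show "verts (deletion \<Delta> v) \<subseteq> verts \<Delta> - {v}"
    unfolding verts_def deletion_def by blast
  show "verts \<Delta> - {v} \<subseteq> verts (deletion \<Delta> v)"
  proof
    fix u assume "u \<in> verts \<Delta> - {v}"
    then have "{u} \<in> deletion \<Delta> v"
      using assms by (auto simp: finite_simplicial_complex_def deletion_def verts_def)
    then show "u \<in> verts (deletion \<Delta> v)"
      unfolding verts_def by blast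
  qed
qed

lemma verts_link_subset: "verts (link \<Delta> v) \<subseteq> verts \<Delta> - {v}"
  by (auto simp: verts_def link_def)

text \<open>Deleting a vertex \<open>v\<close> other than the apex, or taking its link, gives a cone
  with the same apex and fewer vertices, until only the point \<open>y\<close> remains. Nonvoidness
  makes \<open>{}\<close> and hence \<open>{y}\<close> a face; the closure condition alone holds
  vacuously in the void complex.\<close>

lemma cone_nonevasive:
  assumes "finite_simplicial_complex \<Delta>" "\<Delta> \<noteq> {}" "\<And>S. S \<in> \<Delta> \<Longrightarrow> insert y S \<in> \<Delta>"
  shows "nonevasive \<Delta>"
  using assms
proof (induction "card (verts \<Delta>)" arbitrary: \<Delta> rule: less_induct)
  case less
  have down: "T \<in> \<Delta>" if "S \<in> \<Delta>" "T \<subseteq> S" for S T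
    using less.prems(1) that by (auto simp: finite_simplicial_complex_def)
  have empty: "{} \<in> \<Delta>"
    using less.prems(2) down by blast
  with less.prems(3) have y: "{y} \<in> \<Delta>"
    by blast
  show ?case
  proof (cases "verts \<Delta> \<subseteq> {y}")
    case True
    then have "\<Delta> \<subseteq> {{}, {y}}"
      by (auto simp: verts_def)
    with empty y have "\<Delta> = {{}, {y}}"
      by blast
    then show ?thesis
      using nonevasive.point[of y] by simp
  next
    case False
    then obtain v where v: "v \<in> verts \<Delta>" "v \<noteq> y"
      by blast
    then have "{v} \<in> \<Delta>"
      using down by (auto simp: verts_def)
    have smaller: "card A < card (verts \<Delta>)" if "A \<subseteq> verts \<Delta> - {v}" for A
      using that v(1) finite_verts[OF less.prems(1)] by (intro psubset_card_mono) auto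
    have "nonevasive (deletion \<Delta> v)"
    proof (rule less.hyps)
      show "card (verts (deletion \<Delta> v)) < card (verts \<Delta>)"
        using less.prems(1) by (intro smaller) (simp add: verts_deletion)
      show "finite_simplicial_complex (deletion \<Delta> v)"
        using less.prems(1) by (rule complex_deletion)
      show "deletion \<Delta> v \<noteq> {}"
        using empty by (auto simp: deletion_def)
      show "insert y S \<in> deletion \<Delta> v" if "S \<in> deletion \<Delta> v" for S
        using that v(2) less.prems(3) by (auto simp: deletion_def)
    qed
    moreover have "nonevasive (link \<Delta> v)"
    proof (rule less.hyps)
      show "card (verts (link \<Delta> v)) < card (verts \<Delta>)"
        by (intro smaller verts_link_subset)
      show "finite_simplicial_complex (link \<Delta> v)"
        using less.prems(1) by (rule complex_link)
      show "link \<Delta> v \<noteq> {}"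
        using empty \<open>{v} \<in> \<Delta>\<close> by (auto simp: link_def)
      \<comment> \<open>Membership in the link asks for two faces, \<open>insert y S\<close> and
        \<open>insert v (insert y S)\<close>, so the cone condition is applied both to
        \<open>S\<close> and to \<open>insert v S\<close>.\<close>
      show "insert y S \<in> link \<Delta> v" if "S \<in> link \<Delta> v" for S
        using that v(2) less.prems(3)[of S] less.prems(3)[of "insert v S"]
        by (auto simp: link_def insert_commute)
    qed
    ultimately show ?thesis
      by (rule nonevasive.del_link[OF less.prems(1) v(1)])
  qed
qed

lemma NE_step_deletion_dominated:
  assumes \<Delta>: "finite_simplicial_complex \<Delta>" and "x \<in> verts \<Delta>" "x \<noteq> y"
    and dom: "\<And>S. S \<in> \<Delta> \<Longrightarrow> x \<in> S \<Longrightarrow> insert y S \<in> \<Delta>"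
  shows "NE_step \<Delta> (deletion \<Delta> x)"
proof -
  have "{} \<in> link \<Delta> x"
    using \<Delta> \<open>x \<in> verts \<Delta>\<close> by (auto simp: finite_simplicial_complex_def verts_def link_def)
  moreover have "insert y S \<in> link \<Delta> x" if "S \<in> link \<Delta> x" for S
  proof -
    have "insert x (insert y S) \<in> \<Delta>"
      using that dom[of "insert x S"] by (simp add: link_def insert_commute)
    moreover from this have "insert y S \<in> \<Delta>"
      using \<Delta> unfolding finite_simplicial_complex_def by blast
    ultimately show ?thesis
      using that \<open>x \<noteq> y\<close> by (simp add: link_def)
  qed
  ultimately have "nonevasive (link \<Delta> x)"
    using complex_link[OF \<Delta>] by (intro cone_nonevasive[of _ y]) auto
  then show ?thesis
    using \<open>x \<in> verts \<Delta>\<close> by (auto simp: NE_step_def)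
qed

text \<open>A facet \<open>F\<close> through \<open>x\<close> contains \<open>y\<close>, and
  \<open>F - {y}\<close> lies in no other facet. Collapsing at \<open>F - {y}\<close> removes
  exactly the pair \<open>F - {y}\<close>, \<open>F\<close> and preserves the domination of
  \<open>x\<close> by \<open>y\<close>, so induction on the number of faces applies. It ends once no
  face contains \<open>x\<close>, which is why \<open>x\<close> is not assumed to be a
  vertex.\<close>

lemma collapses_deletion_dominated:
  assumes "finite_simplicial_complex \<Delta>" "x \<noteq> y"
    and "\<And>S. S \<in> \<Delta> \<Longrightarrow> x \<in> S \<Longrightarrow> insert y S \<in> \<Delta>"
  shows "collapses \<Delta> (deletion \<Delta> x)"
  using assms
proof (induction "card \<Delta>" arbitrary: \<Delta> rule: less_induct)
  case less
  have down: "T \<in> \<Delta>" if "S \<in> \<Delta>" "T \<subseteq> S" for S T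
    using less.prems(1) that by (auto simp: finite_simplicial_complex_def)
  show ?case
  proof (cases "\<exists>S\<in>\<Delta>. x \<in> S")
    case False
    then have "deletion \<Delta> x = \<Delta>"
      by (auto simp: deletion_def)
    then show ?thesis
      by (simp add: collapses_def)
  next
    case True
    then obtain F where F: "F \<in> facets \<Delta>" "x \<in> F"
      using complex_facet_above[OF less.prems(1)] by blast
    have y_mem: "y \<in> G" if "G \<in> facets \<Delta>" "x \<in> G" for G
      using that less.prems(3)[of G] by (auto simp: facets_def)
    define S where "S = F - {y}"
    have S: "S \<in> \<Delta>" "x \<in> S" "y \<notin> S" "S \<subseteq> F" "S \<noteq> F"
      using F y_mem less.prems(2) down by (auto simp: S_def facets_def)
    \<comment> \<open>As \<open>S\<close> still contains \<open>x\<close>, so does \<open>G\<close>;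
      then \<open>G\<close> contains \<open>y\<close> as well, and therefore all of
      \<open>F\<close>.\<close>
    have "G = F" if "G \<in> facets \<Delta>" "S \<subseteq> G" for G
    proof -
      have "F \<subseteq> G"
        using that S(2) y_mem by (auto simp: S_def)
      then show ?thesis
        using that F by (auto simp: facets_def)
    qed
    moreover have "S \<notin> facets \<Delta>"
      using S F by (auto simp: facets_def)
    ultimately have "free_face \<Delta> S"
      using S F unfolding free_face_def by blast
    define \<Gamma> where "\<Gamma> = {T \<in> \<Delta>. \<not> S \<subseteq> T}"
    have "elementary_collapse \<Delta> \<Gamma>"
      using \<open>free_face \<Delta> S\<close> by (auto simp: elementary_collapse_def \<Gamma>_def)
    moreover have "collapses \<Gamma> (deletion \<Gamma> x)"
    proof (rule less.hyps)
      show "card \<Gamma> < card \<Delta>"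
        using less.prems(1) S(1)
        by (intro psubset_card_mono) (auto simp: finite_simplicial_complex_def \<Gamma>_def)
      show "finite_simplicial_complex \<Gamma>"
        using less.prems(1) unfolding finite_simplicial_complex_def \<Gamma>_def by auto
      \<comment> \<open>Since \<open>y\<close> is not in \<open>S\<close>, adding \<open>y\<close>
        to \<open>T\<close> cannot produce a superset of \<open>S\<close> unless \<open>T\<close>
        was one already.\<close>
      show "insert y T \<in> \<Gamma>" if "T \<in> \<Gamma>" "x \<in> T" for T
        using that less.prems(3) S(3) by (auto simp: \<Gamma>_def)
    qed (fact less.prems(2))
    \<comment> \<open>Every face lost in the collapse contains \<open>S\<close> and thus
      \<open>x\<close>, so the target of the collapses does not change.\<close>
    moreover have "deletion \<Gamma> x = deletion \<Delta> x"
      using S(2) by (auto simp: deletion_def \<Gamma>_def)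
    ultimately show ?thesis
      unfolding collapses_def by (metis converse_rtranclp_into_rtranclp)
  qed
qed

text \<open>Induction on the number of vertices outside \<open>W\<close>. The dominating vertices
  are required to lie in \<open>W\<close> because these are never deleted: each remaining vertex
  outside \<open>W\<close> keeps its dominating vertex after every deletion.\<close>

lemma reduces_induced_subcomplex_dominating:
  assumes "finite_simplicial_complex \<Delta>"
    and "\<And>x. x \<in> verts \<Delta> - W \<Longrightarrow> \<exists>y\<in>W. \<forall>S\<in>\<Delta>. x \<in> S \<longrightarrow> insert y S \<in> \<Delta>"
  shows "NE_reduces \<Delta> (induced_subcomplex \<Delta> W) \<and> collapses \<Delta> (induced_subcomplex \<Delta> W)"
  using assms
proof (induction "card (verts \<Delta> - W)" arbitrary: \<Delta> rule: less_induct)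
  case less
  show ?case
  proof (cases "verts \<Delta> \<subseteq> W")
    case True
    then have "induced_subcomplex \<Delta> W = \<Delta>"
      by (auto simp: induced_subcomplex_def verts_def)
    then show ?thesis
      by (simp add: NE_reduces_def collapses_def)
  next
    case False
    then obtain x where x: "x \<in> verts \<Delta>" "x \<notin> W"
      by blast
    then obtain y where y: "y \<in> W" "\<And>S. S \<in> \<Delta> \<Longrightarrow> x \<in> S \<Longrightarrow> insert y S \<in> \<Delta>"
      using less.prems(2) by blast
    have "x \<noteq> y"
      using x(2) y(1) by blast
    let ?\<Gamma> = "deletion \<Delta> x"
    have "NE_step \<Delta> ?\<Gamma>" "collapses \<Delta> ?\<Gamma>"
      using NE_step_deletion_dominated[OF less.prems(1) x(1) \<open>x \<noteq> y\<close> y(2)]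
        collapses_deletion_dominated[OF less.prems(1) \<open>x \<noteq> y\<close> y(2)] by auto
    moreover have "NE_reduces ?\<Gamma> (induced_subcomplex ?\<Gamma> W) \<and> collapses ?\<Gamma> (induced_subcomplex ?\<Gamma> W)"
    proof (rule less.hyps)
      show "card (verts ?\<Gamma> - W) < card (verts \<Delta> - W)"
        using x less.prems(1)
        by (intro psubset_card_mono) (auto simp: verts_deletion finite_verts)
      show "finite_simplicial_complex ?\<Gamma>"
        using less.prems(1) by (rule complex_deletion)
      show "\<exists>w\<in>W. \<forall>S\<in>?\<Gamma>. u \<in> S \<longrightarrow> insert w S \<in> ?\<Gamma>" if "u \<in> verts ?\<Gamma> - W" for u
      proof -
        have "u \<in> verts \<Delta> - W"
          using that less.prems(1) by (simp add: verts_deletion)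
        then obtain w where "w \<in> W" "\<forall>S\<in>\<Delta>. u \<in> S \<longrightarrow> insert w S \<in> \<Delta>"
          using less.prems(2) by blast
        \<comment> \<open>The vertex \<open>w\<close> differs from \<open>x\<close>, as only
          \<open>w\<close> is in \<open>W\<close>; so adding \<open>w\<close> to a face avoiding
          \<open>x\<close> gives a face avoiding \<open>x\<close>.\<close>
        then show ?thesis
          using x(2) by (auto simp: deletion_def intro!: bexI[of _ w])
      qed
    qed
    moreover have "induced_subcomplex ?\<Gamma> W = induced_subcomplex \<Delta> W"
      using x(2) by (auto simp: induced_subcomplex_def deletion_def)
    ultimately show ?thesis
      unfolding NE_reduces_def collapses_def
      by (metis converse_rtranclp_into_rtranclp rtranclp_trans)
  qed
qed

text \<open>The color of a vertex \<open>x\<close> outside \<open>W\<close> lies in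
  \<open>{1..k}\<close>, so \<open>W\<close> has a vertex \<open>y\<close> of that color, and the
  facet condition on representatives makes \<open>y\<close> dominate \<open>x\<close>.\<close>

lemma LC_step_reduces:
  assumes \<Delta>: "finite_simplicial_complex \<Delta>" and "LC_step \<Delta> \<Delta>'"
  shows "finite_simplicial_complex \<Delta>' \<and> NE_reduces \<Delta> \<Delta>' \<and> collapses \<Delta> \<Delta>'"
proof -
  obtain k :: nat and \<kappa> W where \<kappa>: "\<kappa> ` verts \<Delta> = {1..k}"
    and W: "\<forall>t\<in>{1..k}. \<exists>!w. w \<in> W \<and> \<kappa> w = t"
      "\<forall>x\<in>verts \<Delta>. \<forall>y\<in>W. \<kappa> x = \<kappa> y \<longrightarrow> facets_at \<Delta> x \<subseteq> facets_at \<Delta> y"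
    and \<Delta>': "\<Delta>' = induced_subcomplex \<Delta> W"
    using \<open>LC_step \<Delta> \<Delta>'\<close>
    unfolding LC_step_def linear_coloring_def representative_subcomplex_def by blast
  have "\<exists>y\<in>W. \<forall>S\<in>\<Delta>. x \<in> S \<longrightarrow> insert y S \<in> \<Delta>" if "x \<in> verts \<Delta> - W" for x
  proof -
    have "\<kappa> x \<in> {1..k}"
      using that \<kappa> by blast
    then obtain y where "y \<in> W" "\<kappa> y = \<kappa> x"
      using W(1) by blast
    moreover from this have "facets_at \<Delta> x \<subseteq> facets_at \<Delta> y"
      using that W(2) by simp
    ultimately show ?thesis
      using facets_at_subset_insert_mem[OF \<Delta>] by blast
  qed
  moreover have "finite_simplicial_complex \<Delta>'"
    using \<Delta> unfolding \<Delta>' finite_simplicial_complex_def induced_subcomplex_def by auto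
  ultimately show ?thesis
    using reduces_induced_subcomplex_dominating[OF \<Delta>] \<Delta>' by blast
qed

theorem theorem1p2:
  fixes \<Delta> \<Delta>' :: "'a set set"
  assumes "finite_simplicial_complex \<Delta>"
    and "subcomplex \<Delta>' \<Delta>"
    and "LC_reduces \<Delta> \<Delta>'"
  shows "NE_reduces \<Delta> \<Delta>' \<and> collapses \<Delta> \<Delta>'"
proof -
  \<comment> \<open>That each term of the LC-sequence is again a complex is carried through the
    induction, because the next step is analysed under that assumption.\<close>
  have "finite_simplicial_complex \<Delta>' \<and> NE_reduces \<Delta> \<Delta>' \<and> collapses \<Delta> \<Delta>'"
    using \<open>LC_reduces \<Delta> \<Delta>'\<close> unfolding LC_reduces_def
  proof (induction rule: rtranclp_induct)
    case base
    show ?case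
      using assms(1) by (simp add: NE_reduces_def collapses_def)
  next
    case (step \<Gamma> \<Gamma>')
    then show ?case
      using LC_step_reduces[of \<Gamma> \<Gamma>'] unfolding NE_reduces_def collapses_def
      by (meson rtranclp_trans)
  qed
  then show ?thesis
    by blast
qed

end
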